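(* Let $\epsilon\in\{1,-1\}$, let $\gamma\in\mathbb{R}$ with $\gamma\neq 0$, and consider the equation $$i\psi_t+\psi_{xx}+(\epsilon+i\gamma)\frac{1}{x}|\psi|^2\psi+\frac{5}{36}\,\frac{1}{x^2}\,\psi=0,\qquad x\in\mathbb{R}\setminus\{0\}. \qquad ( * )$$ For any $T>0$ there is a solution $\psi(x,t)$ of $( * )$ on $(\mathbb{R}\setminus\{0\})\times[0,T)$ such that $$\lim_{t\to T^-}\|\psi(\cdot,t)\|_p=+\infty\quad\text{for all } p>2,$$ where $\|\psi(\cdot,t)\|_p=\Bigl(\int_{-\infty}^{+\infty}|\psi(x,t)|^p\,dx\Bigr)^{1/p}$.
   Context: The unknown $\psi=\psi(x,t)$ is complex-valued. A solution means a pointwise solution in the classical sense. No initial condition is prescribed: the solution may have whatever initial value $\psi(x,0)$ it has. *)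

theory Defs
  imports "HOL-Analysis.Analysis"
begin

text \<open>
  A classical solution on \<open>(\<real> - {0}) \<times> [0, T)\<close>: the derivatives \<open>\<psi>\<^sub>t\<close>, \<open>\<psi>\<^sub>x\<close>, \<open>\<psi>\<^sub>x\<^sub>x\<close> exist
  at every point, are jointly continuous together with \<open>\<psi>\<close>, and satisfy the equation pointwise.
  The time derivative is one-sided at \<open>t = 0\<close>, and \<open>\<psi>\<close> is unconstrained on the line \<open>x = 0\<close>.
\<close>

definition classical_solution ::
    "real \<Rightarrow> real \<Rightarrow> real \<Rightarrow> (real \<Rightarrow> real \<Rightarrow> complex) \<Rightarrow> bool" where
  "classical_solution \<epsilon> \<gamma> T \<psi> \<longleftrightarrow>
    (\<exists>\<psi>t \<psi>x \<psi>xx :: real \<Rightarrow> real \<Rightarrow> complex.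
      (\<forall>f\<in>{\<psi>, \<psi>t, \<psi>x, \<psi>xx}. continuous_on ((UNIV - {0}) \<times> {0..<T}) (\<lambda>(x, t). f x t)) \<and>
      (\<forall>x t. x \<noteq> 0 \<and> 0 \<le> t \<and> t < T \<longrightarrow>
        ((\<lambda>s. \<psi> x s) has_vector_derivative \<psi>t x t) (at t within {0..<T}) \<and>
        ((\<lambda>y. \<psi> y t) has_vector_derivative \<psi>x x t) (at x) \<and>
        ((\<lambda>y. \<psi>x y t) has_vector_derivative \<psi>xx x t) (at x) \<and>
        \<i> * \<psi>t x t + \<psi>xx x t
          + (of_real \<epsilon> + \<i> * of_real \<gamma>) * of_real (1 / x) * of_real ((cmod (\<psi> x t))\<^sup>2) * \<psi> x t
          + of_real (5 / 36) * of_real (1 / x\<^sup>2) * \<psi> x t = 0))"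

text \<open>
  The Bochner integral of a non-integrable function is \<open>0\<close>, so \<open>lp_norm p f\<close> is the p-norm only
  when \<open>\<lambda>x. cmod (f x) powr p\<close> is integrable.
\<close>

definition lp_norm :: "real \<Rightarrow> (real \<Rightarrow> complex) \<Rightarrow> real" where
  "lp_norm p f = (LINT x|lborel. cmod (f x) powr p) powr (1 / p)"

end

theory Submission
  imports Defs
begin

text \<open>
  The equation is invariant under the scaling
  \<open>\<psi>(x, t) \<mapsto> \<lambda>^(1/2) \<psi>(\<lambda>x, \<lambda>^2t)\<close>, which preserves the \<open>L^2\<close> norm: the weight \<open>1/x\<close> makes
  the cubic nonlinearity mass-critical in one dimension, and \<open>1/x^2\<close> scales like \<open>\<partial>\<^sub>x^2\<close>.
  It therefore also has the pseudoconformal symmetry, which turns a stationary solution \<open>\<phi>\<close> into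
  \<open>\<psi>(x, t) = (T - t)^(-1/2) exp(-i x^2 / (4(T - t))) \<phi>(x / (T - t))\<close>,
  and by substitution \<open>\<parallel>\<psi>(\<cdot>, t)\<parallel>\<^sub>p = (T - t)^(1/p-1/2) \<parallel>\<phi>\<parallel>\<^sub>p\<close>. The exponent is negative exactly when
  \<open>p > 2\<close>, so any nonzero stationary \<open>\<phi>\<close> lying in every \<open>L^p\<close> with \<open>p > 2\<close> gives the blow-up
  (\<open>pseudoconformal_classical_solution\<close>, \<open>pseudoconformal_blowup\<close>).

  To find \<open>\<phi>\<close>, note that the linear part \<open>\<phi>'' + 5/36 x^(-2) \<phi>\<close> has the solutions \<open>x^(1/6)\<close> and
  \<open>x^(5/6)\<close>, whose quotient is \<open>x^(2/3)\<close>. Writing \<open>\<phi>(x) = x^(1/6) w(x^(2/3))\<close> for \<open>x > 0\<close> removes the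
  linear potential and, thanks to the value \<open>5/36\<close>, leaves the autonomous equation
  \<open>4/9 w'' + (\<epsilon> + i\<gamma>)|w|^2w = 0\<close> (\<open>similarity_profile_stationary\<close>). This has the explicit solution
  \<open>w(z) = A (1 + z)^c\<close> with \<open>Re c = -1\<close>, where the two real unknowns \<open>A\<close> and \<open>Im c\<close> are found from the
  complex equation \<open>4/9 c(c - 1) + (\<epsilon> + i\<gamma>)A^2 = 0\<close>; it is solvable for either sign of \<open>\<epsilon>\<close> because
  \<open>\<gamma> \<noteq> 0\<close> (\<open>exists_power_parameters\<close>). The modulus \<open>A x^(1/6) / (1 + x^(2/3))\<close> of the resulting \<open>\<phi>\<close> is
  bounded and decays like \<open>x^(-1/2)\<close>, which is in \<open>L^p\<close> at infinity for all \<open>p > 2\<close>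
  (\<open>profile_Lp\<close>). No condition links the two sides of \<open>x = 0\<close>, so \<open>\<phi>\<close> may be \<open>0\<close> on
  the negative half-line.
\<close>

section \<open>The pseudoconformal transformation\<close>

definition pseudoconformal :: "real \<Rightarrow> (real \<Rightarrow> complex) \<Rightarrow> real \<Rightarrow> real \<Rightarrow> complex" where
  "pseudoconformal T \<phi> x t =
    of_real ((T - t) powr (-1/2)) * exp (- (\<i> * of_real (x\<^sup>2 / (4 * (T - t))))) * \<phi> (x / (T - t))"

text \<open>
  The time-independent equation at the single point \<open>y\<close>, for the value \<open>f\<close> and the second
  derivative \<open>f''\<close> there. Being purely algebraic, it does not commit to a way of expressing derivatives.
\<close>

definition stationary_solution_at :: "real \<Rightarrow> real \<Rightarrow> real \<Rightarrow> complex \<Rightarrow> complex \<Rightarrow> bool" where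
  "stationary_solution_at \<epsilon> \<gamma> y f f'' \<longleftrightarrow>
    f'' + (of_real \<epsilon> + \<i> * of_real \<gamma>) * of_real (1 / y) * of_real ((cmod f)\<^sup>2) * f
      + of_real (5 / 36) * of_real (1 / y\<^sup>2) * f = 0"

lemma has_vector_derivative_exp_phase:
  assumes "(g has_real_derivative g') (at s within S)"
  shows "((\<lambda>s. exp (- (\<i> * of_real (g s)))) has_vector_derivative
    - (\<i> * of_real g' * exp (- (\<i> * of_real (g s))))) (at s within S)"
proof -
  have "((\<lambda>s. - (\<i> * of_real (g s))) has_vector_derivative - (\<i> * of_real g')) (at s within S)"
    by (intro has_vector_derivative_minus has_vector_derivative_mult_right
        has_vector_derivative_of_real assms)
  from field_vector_diff_chain_within[OF this, of exp "exp (- (\<i> * of_real (g s)))"]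
  show ?thesis
    by (auto simp: o_def intro: DERIV_exp has_field_derivative_at_within)
qed

text \<open>
  With \<open>\<tau> = T - t\<close> and \<open>y = x/\<tau>\<close>, the quadratic phase is chosen so that the terms in \<open>\<phi>\<close> and \<open>\<phi>'\<close>
  produced by \<open>i\<psi>\<^sub>t\<close> cancel those produced by \<open>\<psi>\<^sub>x\<^sub>x\<close>; only \<open>\<tau>^(-2)\<phi>''(y)\<close> survives, up to the common
  factor. The nonlinear and the potential term carry the same \<open>\<tau>^(-2)\<close>, since
  \<open>x^(-1)|\<psi>|^2 = \<tau>^(-2)y^(-1)|\<phi>(y)|^2\<close> and \<open>x^(-2) = \<tau>^(-2)y^(-2)\<close>.
\<close>

lemma pseudoconformal_classical_solution:
  fixes \<phi> \<phi>' \<phi>'' :: "real \<Rightarrow> complex"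
  assumes d1: "\<And>y. y \<noteq> 0 \<Longrightarrow> (\<phi> has_vector_derivative \<phi>' y) (at y)"
    and d2: "\<And>y. y \<noteq> 0 \<Longrightarrow> (\<phi>' has_vector_derivative \<phi>'' y) (at y)"
    and stat: "\<And>y. y \<noteq> 0 \<Longrightarrow> stationary_solution_at \<epsilon> \<gamma> y (\<phi> y) (\<phi>'' y)"
  shows "classical_solution \<epsilon> \<gamma> T (pseudoconformal T \<phi>)"
proof -
  let ?D = "(UNIV - {0::real}) \<times> {0..<T}"
  define R where "R = (\<lambda>t. (T - t) powr (-1/2))"
  define E where "E = (\<lambda>x t. exp (- (\<i> * of_real (x\<^sup>2 / (4 * (T - t))))))"
  define \<psi>t where "\<psi>t = (\<lambda>x t. of_real (R t) * E x t *
    (of_real (1 / (2 * (T - t))) * \<phi> (x / (T - t))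
      - \<i> * of_real (x\<^sup>2 / (4 * (T - t)\<^sup>2)) * \<phi> (x / (T - t))
      + of_real (x / (T - t)\<^sup>2) * \<phi>' (x / (T - t))))"
  define \<psi>x where "\<psi>x = (\<lambda>x t. of_real (R t) * E x t *
    (of_real (1 / (T - t)) * \<phi>' (x / (T - t))
      - \<i> * of_real (x / (2 * (T - t))) * \<phi> (x / (T - t))))"
  define \<psi>xx where "\<psi>xx = (\<lambda>x t. of_real (R t) * E x t *
    (of_real (1 / (T - t)\<^sup>2) * \<phi>'' (x / (T - t))
      - \<i> * of_real (1 / (2 * (T - t))) * \<phi> (x / (T - t))
      - of_real (x\<^sup>2 / (4 * (T - t)\<^sup>2)) * \<phi> (x / (T - t))
      - \<i> * of_real (x / (T - t)\<^sup>2) * \<phi>' (x / (T - t))))"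
  have psi: "pseudoconformal T \<phi> = (\<lambda>x t. of_real (R t) * E x t * \<phi> (x / (T - t)))"
    by (intro ext) (simp add: pseudoconformal_def R_def E_def)

  have c1: "continuous_on (UNIV - {0}) \<phi>"
    using d1 by (intro continuous_at_imp_continuous_on) (auto intro: has_vector_derivative_continuous)
  have c2: "continuous_on (UNIV - {0}) \<phi>'"
    using d2 by (intro continuous_at_imp_continuous_on) (auto intro: has_vector_derivative_continuous)
  \<comment> \<open>Continuity of the second derivative is not assumed: the equation expresses it through \<open>\<phi>\<close>.\<close>
  have c3: "continuous_on (UNIV - {0}) \<phi>''"
  proof -
    have eq: "\<phi>'' y = - ((of_real \<epsilon> + \<i> * of_real \<gamma>) * of_real (1 / y) * of_real ((cmod (\<phi> y))\<^sup>2) * \<phi> y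
      + of_real (5 / 36) * of_real (1 / y\<^sup>2) * \<phi> y)" if "y \<noteq> 0" for y
      using stat[OF that] unfolding stationary_solution_at_def
      by (simp only: eq_neg_iff_add_eq_0 add.assoc)
    have "continuous_on (UNIV - {0}) (\<lambda>y. - ((of_real \<epsilon> + \<i> * of_real \<gamma>) * of_real (1 / y) * of_real ((cmod (\<phi> y))\<^sup>2) * \<phi> y
      + of_real (5 / 36) * of_real (1 / y\<^sup>2) * \<phi> y))"
      by (intro continuous_intros c1) auto
    then show ?thesis
      by (rule continuous_on_eq) (use eq in auto)
  qed
  have comp: "continuous_on ?D (\<lambda>z. f (fst z / (T - snd z)))"
    if "continuous_on (UNIV - {0}) f" for f :: "real \<Rightarrow> complex"
    by (rule continuous_on_compose2[OF that]) (auto intro!: continuous_intros)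
  have cR: "continuous_on ?D (\<lambda>z. complex_of_real (R (snd z)))"
    unfolding R_def by (intro continuous_intros) auto
  have cE: "continuous_on ?D (\<lambda>z. E (fst z) (snd z))"
    unfolding E_def by (intro continuous_intros) auto
  have coeff: "continuous_on ?D (\<lambda>z. complex_of_real (1 / (2 * (T - snd z))))"
    "continuous_on ?D (\<lambda>z. complex_of_real (1 / (T - snd z)))"
    "continuous_on ?D (\<lambda>z. complex_of_real (1 / (T - snd z)\<^sup>2))"
    "continuous_on ?D (\<lambda>z. complex_of_real (fst z / (T - snd z)\<^sup>2))"
    "continuous_on ?D (\<lambda>z. complex_of_real (fst z / (2 * (T - snd z))))"
    "continuous_on ?D (\<lambda>z. complex_of_real ((fst z)\<^sup>2 / (4 * (T - snd z)\<^sup>2)))"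
    by (intro continuous_intros; auto)+
  note ci = coeff cR cE comp[OF c1] comp[OF c2] comp[OF c3] continuous_on_mult continuous_on_add continuous_on_diff continuous_on_const
  have cont: "\<forall>f\<in>{pseudoconformal T \<phi>, \<psi>t, \<psi>x, \<psi>xx}. continuous_on ?D (\<lambda>(x, t). f x t)"
    unfolding psi \<psi>t_def \<psi>x_def \<psi>xx_def case_prod_beta
    by (simp only: ball_simps simp_thms, intro conjI ci)

  have pw: "((\<lambda>s. pseudoconformal T \<phi> x s) has_vector_derivative \<psi>t x t) (at t within {0..<T}) \<and>
        ((\<lambda>y. pseudoconformal T \<phi> y t) has_vector_derivative \<psi>x x t) (at x) \<and>
        ((\<lambda>y. \<psi>x y t) has_vector_derivative \<psi>xx x t) (at x) \<and>
        \<i> * \<psi>t x t + \<psi>xx x t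
          + (of_real \<epsilon> + \<i> * of_real \<gamma>) * of_real (1 / x) * of_real ((cmod (pseudoconformal T \<phi> x t))\<^sup>2) * pseudoconformal T \<phi> x t
          + of_real (5 / 36) * of_real (1 / x\<^sup>2) * pseudoconformal T \<phi> x t = 0"
    if x: "x \<noteq> 0" and t: "0 \<le> t" "t < T" for x t
  proof (intro conjI)
    define y where "y = x / (T - t)"
    have y: "y \<noteq> 0" using x t by (simp add: y_def)
    have tau: "T - t > 0" using t by simp
    have Rt: "((\<lambda>s. complex_of_real (R s)) has_vector_derivative of_real (R t / (2 * (T - t)))) (at t within {0..<T})"
    proof (rule has_vector_derivative_of_real)
      have "(R has_real_derivative (1/2) * (T - t) powr (-1/2 - 1)) (at t within {0..<T})"
        unfolding R_def using tau by (auto intro!: derivative_eq_intros)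
      moreover have "(1/2) * (T - t) powr (-1/2 - 1) = R t / (2 * (T - t))"
        unfolding R_def using tau by (simp only: powr_diff) simp
      ultimately show "(R has_real_derivative R t / (2 * (T - t))) (at t within {0..<T})"
        by (simp only:)
    qed
    have Et: "((\<lambda>s. E x s) has_vector_derivative - (\<i> * of_real (x\<^sup>2 / (4 * (T - t)\<^sup>2)) * E x t)) (at t within {0..<T})"
      unfolding E_def
      by (rule has_vector_derivative_exp_phase)
        (use tau in \<open>auto intro!: derivative_eq_intros simp: power2_eq_square divide_simps simp del: right_diff_distrib_numeral\<close>)
    have Ex: "((\<lambda>y. E y t) has_vector_derivative - (\<i> * of_real (x / (2 * (T - t))) * E x t)) (at x)"
      unfolding E_def
      by (rule has_vector_derivative_exp_phase)
        (use tau in \<open>auto intro!: derivative_eq_intros simp: power2_eq_square divide_simps simp del: right_diff_distrib_numeral\<close>)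
    have phit: "((\<lambda>s. f (x / (T - s))) has_vector_derivative of_real (x / (T - t)\<^sup>2) * f' y) (at t within {0..<T})"
      if "\<And>y. y \<noteq> 0 \<Longrightarrow> (f has_vector_derivative f' y) (at y)" for f f' :: "real \<Rightarrow> complex"
    proof -
      have "((\<lambda>s. x / (T - s)) has_vector_derivative x / (T - t)\<^sup>2) (at t within {0..<T})"
        unfolding has_real_derivative_iff_has_vector_derivative[symmetric]
        using tau by (auto intro!: derivative_eq_intros simp: power2_eq_square)
      from vector_diff_chain_within[OF this has_vector_derivative_at_within[OF that[OF y, unfolded y_def]]]
      show ?thesis by (simp add: o_def y_def scaleR_conv_of_real)
    qed
    have phix: "((\<lambda>x. f (x / (T - t))) has_vector_derivative of_real (1 / (T - t)) * f' y) (at x)"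
      if "\<And>y. y \<noteq> 0 \<Longrightarrow> (f has_vector_derivative f' y) (at y)" for f f' :: "real \<Rightarrow> complex"
    proof -
      have "((\<lambda>x. x / (T - t)) has_vector_derivative 1 / (T - t)) (at x)"
        unfolding has_real_derivative_iff_has_vector_derivative[symmetric]
        using tau by (auto intro!: derivative_eq_intros)
      from vector_diff_chain_at[OF this that[OF y, unfolded y_def]]
      show ?thesis by (simp add: o_def y_def scaleR_conv_of_real)
    qed
    have cx: "((\<lambda>y. \<i> * complex_of_real (y / (2 * (T - t)))) has_vector_derivative \<i> * of_real (1 / (2 * (T - t)))) (at x)"
      by (intro has_vector_derivative_mult_right has_vector_derivative_of_real)
         (use tau in \<open>auto intro!: derivative_eq_intros\<close>)
    \<comment> \<open>Once every coefficient is a polynomial in \<open>a = 1/(T - t)\<close>, the derivative formulas are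
      polynomial identities.\<close>
    define a where "a = complex_of_real (1 / (T - t))"
    have k: "complex_of_real (u / (2 * \<tau>)) = of_real u * of_real (1 / \<tau>) / 2"
      "complex_of_real (u / \<tau>\<^sup>2) = of_real u * (of_real (1 / \<tau>))\<^sup>2"
      "complex_of_real (u / (4 * \<tau>\<^sup>2)) = of_real u * (of_real (1 / \<tau>))\<^sup>2 / 4" for u \<tau> :: real
      by (simp_all add: power2_eq_square)
    show "((\<lambda>s. pseudoconformal T \<phi> x s) has_vector_derivative \<psi>t x t) (at t within {0..<T})"
      unfolding psi
      by (rule has_vector_derivative_eq_rhs[OF has_vector_derivative_mult[OF has_vector_derivative_mult[OF Rt Et] phit[OF d1]]])
        (simp_all only: \<psi>t_def y_def[symmetric] k a_def[symmetric], simp_all add: algebra_simps power2_eq_square)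
    show "((\<lambda>y. pseudoconformal T \<phi> y t) has_vector_derivative \<psi>x x t) (at x)"
      unfolding psi
      by (rule has_vector_derivative_eq_rhs[OF has_vector_derivative_mult[OF has_vector_derivative_mult_right[OF Ex] phix[OF d1]]])
        (simp_all only: \<psi>x_def y_def[symmetric] k a_def[symmetric], simp_all add: algebra_simps power2_eq_square)
    show "((\<lambda>y. \<psi>x y t) has_vector_derivative \<psi>xx x t) (at x)"
      unfolding \<psi>x_def
      by (rule has_vector_derivative_eq_rhs[OF has_vector_derivative_mult[OF has_vector_derivative_mult_right[OF Ex] 
           has_vector_derivative_diff[OF has_vector_derivative_mult_right[OF phix[OF d2]] has_vector_derivative_mult[OF cx phix[OF d1]]]]])
        (simp_all only: \<psi>xx_def y_def[symmetric] k a_def[symmetric], simp_all add: algebra_simps power2_eq_square)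
    have st: "\<phi>'' y + (of_real \<epsilon> + \<i> * of_real \<gamma>) * of_real (1 / y) * of_real ((cmod (\<phi> y))\<^sup>2) * \<phi> y
      + of_real (5 / 36) * of_real (1 / y\<^sup>2) * \<phi> y = 0"
      using stat[OF y] by (simp add: stationary_solution_at_def)
    have R2: "(R t)\<^sup>2 = 1 / (T - t)"
      using tau by (simp add: R_def powr_minus powr_half_sqrt power_divide divide_simps flip: powr_power)
    have nE: "cmod (E x t) = 1" by (simp add: E_def)
    have nrm: "(cmod (pseudoconformal T \<phi> x t))\<^sup>2 = (cmod (\<phi> y))\<^sup>2 / (T - t)"
      by (simp add: psi norm_mult nE power_mult_distrib R2 y_def)
    have x1: "1 / x * ((cmod (\<phi> y))\<^sup>2 / (T - t)) = 1 / (T - t)\<^sup>2 * (1 / y * (cmod (\<phi> y))\<^sup>2)"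
      using tau x by (simp add: y_def power2_eq_square)
    have x2: "1 / x\<^sup>2 = 1 / (T - t)\<^sup>2 * (1 / y\<^sup>2)"
      using tau x by (simp add: y_def power2_eq_square)
    have "\<i> * \<psi>t x t + \<psi>xx x t = of_real (R t) * E x t * (of_real (1 / (T - t)\<^sup>2) * \<phi>'' y)"
      by (simp add: \<psi>t_def \<psi>xx_def y_def algebra_simps)
    moreover have "(of_real \<epsilon> + \<i> * of_real \<gamma>) * of_real (1 / x) * of_real ((cmod (pseudoconformal T \<phi> x t))\<^sup>2) * pseudoconformal T \<phi> x t
      = (of_real \<epsilon> + \<i> * of_real \<gamma>) * of_real (1 / x * ((cmod (\<phi> y))\<^sup>2 / (T - t))) * (of_real (R t) * E x t * \<phi> y)"
      unfolding nrm by (simp add: psi y_def)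
    moreover have "of_real (5 / 36) * of_real (1 / x\<^sup>2) * pseudoconformal T \<phi> x t
      = of_real (5 / 36) * of_real (1 / (T - t)\<^sup>2 * (1 / y\<^sup>2)) * (of_real (R t) * E x t * \<phi> y)"
      unfolding x2 by (simp add: psi y_def)
    ultimately have "\<i> * \<psi>t x t + \<psi>xx x t
          + (of_real \<epsilon> + \<i> * of_real \<gamma>) * of_real (1 / x) * of_real ((cmod (pseudoconformal T \<phi> x t))\<^sup>2) * pseudoconformal T \<phi> x t
          + of_real (5 / 36) * of_real (1 / x\<^sup>2) * pseudoconformal T \<phi> x t
      = of_real (R t) * E x t * of_real (1 / (T - t)\<^sup>2) * (\<phi>'' y + (of_real \<epsilon> + \<i> * of_real \<gamma>) * of_real (1 / y) * of_real ((cmod (\<phi> y))\<^sup>2) * \<phi> y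
      + of_real (5 / 36) * of_real (1 / y\<^sup>2) * \<phi> y)"
      unfolding x1 by (simp only: of_real_mult ring_distribs mult_ac)
    then show "\<i> * \<psi>t x t + \<psi>xx x t
          + (of_real \<epsilon> + \<i> * of_real \<gamma>) * of_real (1 / x) * of_real ((cmod (pseudoconformal T \<phi> x t))\<^sup>2) * pseudoconformal T \<phi> x t
          + of_real (5 / 36) * of_real (1 / x\<^sup>2) * pseudoconformal T \<phi> x t = 0"
      unfolding st by simp
  qed
  show ?thesis
    unfolding classical_solution_def using cont pw by blast
qed

section \<open>Scaling of the norms\<close>

lemma pseudoconformal_Lp:
  assumes "t < T" and int: "integrable lborel (\<lambda>x. cmod (\<phi> x) powr p)"
  shows integrable_pseudoconformal: "integrable lborel (\<lambda>x. cmod (pseudoconformal T \<phi> x t) powr p)"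
    and lp_norm_pseudoconformal: "p > 0 \<Longrightarrow>
      lp_norm p (\<lambda>x. pseudoconformal T \<phi> x t) = (T - t) powr (1 / p - 1 / 2) * lp_norm p \<phi>"
proof -
  define \<tau> where "\<tau> = T - t"
  have tau: "\<tau> > 0" using assms by (simp add: \<tau>_def)
  have eq: "cmod (pseudoconformal T \<phi> x t) powr p = \<tau> powr (-p/2) * cmod (\<phi> (0 + (1 / \<tau>) * x)) powr p" for x
    using tau by (simp add: pseudoconformal_def norm_mult powr_mult powr_powr flip: \<tau>_def)
  have i: "integrable lborel (\<lambda>x. cmod (\<phi> (0 + (1 / \<tau>) * x)) powr p)"
    using tau lborel_integrable_real_affine[OF int, of "1/\<tau>" 0] by simp
  show "integrable lborel (\<lambda>x. cmod (pseudoconformal T \<phi> x t) powr p)"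
    unfolding eq using i by simp
  have I: "(LINT x|lborel. cmod (\<phi> (0 + (1 / \<tau>) * x)) powr p) = \<tau> * (LINT x|lborel. cmod (\<phi> x) powr p)"
    using tau lborel_integral_real_affine[of "1/\<tau>" "\<lambda>x. cmod (\<phi> x) powr p" 0] by simp
  assume p: "p > 0"
  have "lp_norm p (\<lambda>x. pseudoconformal T \<phi> x t)
    = (\<tau> powr (-p/2) * \<tau> * (LINT x|lborel. cmod (\<phi> x) powr p)) powr (1 / p)"
    unfolding lp_norm_def eq by (simp only: integral_mult_right_zero I mult.assoc)
  also have "\<tau> powr (-p/2) * \<tau> = \<tau> powr (1 - p/2)"
    using tau by (simp add: powr_mult_base mult.commute)
  also have "(\<tau> powr (1 - p/2) * (LINT x|lborel. cmod (\<phi> x) powr p)) powr (1 / p)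
    = \<tau> powr (1 / p - 1 / 2) * lp_norm p \<phi>"
    using p by (simp add: lp_norm_def powr_mult powr_powr field_simps)
  finally show "lp_norm p (\<lambda>x. pseudoconformal T \<phi> x t) = (T - t) powr (1 / p - 1 / 2) * lp_norm p \<phi>"
    by (simp add: \<tau>_def)
qed

text \<open>
  The hypothesis \<open>p > 2\<close> is what makes the exponent \<open>1/p - 1/2\<close> of \<open>T - t\<close> negative.
\<close>

lemma pseudoconformal_blowup:
  assumes "p > 2" and "integrable lborel (\<lambda>x. cmod (\<phi> x) powr p)" and pos: "lp_norm p \<phi> > 0"
  shows "filterlim (\<lambda>t. lp_norm p (\<lambda>x. pseudoconformal T \<phi> x t)) at_top (at_left T)"
proof -
  have "filterlim (\<lambda>t::real. T - t) (at_right 0) (at_left T)"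
    unfolding filterlim_at
    by (auto intro!: tendsto_eq_intros simp: eventually_at_filter)
  moreover have "filterlim (\<lambda>\<tau>. \<tau> powr (1 / p - 1 / 2)) at_top (at_right (0::real))"
  proof -
    have pos: "1 / 2 - 1 / p > 0" using assms by (simp add: field_simps)
    have "filterlim (\<lambda>\<tau>::real. - ln \<tau>) at_top (at_right 0)"
      using ln_at_0 by (simp add: filterlim_uminus_at_bot)
    then have "filterlim (\<lambda>\<tau>. exp ((1 / 2 - 1 / p) * (- ln \<tau>))) at_top (at_right (0::real))"
      by (intro filterlim_compose[OF exp_at_top] filterlim_tendsto_pos_mult_at_top[OF tendsto_const pos])
    moreover have "(1 / 2 - 1 / p) * (- ln \<tau>) = (1 / p - 1 / 2) * ln \<tau>" for \<tau>
      by (simp add: algebra_simps)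
    ultimately have "filterlim (\<lambda>\<tau>. exp ((1 / p - 1 / 2) * ln \<tau>)) at_top (at_right (0::real))"
      by simp
    then show ?thesis
      by (rule filterlim_cong[THEN iffD1, OF refl refl, rotated])
        (auto simp: eventually_at_filter powr_def)
  qed
  ultimately have "filterlim (\<lambda>t. (T - t) powr (1 / p - 1 / 2)) at_top (at_left T)"
    by (rule filterlim_compose[rotated])
  then have "filterlim (\<lambda>t. (T - t) powr (1 / p - 1 / 2) * lp_norm p \<phi>) at_top (at_left T)"
    by (intro filterlim_at_top_mult_tendsto_pos[OF tendsto_const pos])
  moreover have "eventually (\<lambda>t. (T - t) powr (1 / p - 1 / 2) * lp_norm p \<phi>
      = lp_norm p (\<lambda>x. pseudoconformal T \<phi> x t)) (at_left T)"
    using assms by (auto simp: eventually_at_filter lp_norm_pseudoconformal)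
  ultimately show ?thesis
    by (rule filterlim_cong[THEN iffD1, OF refl refl, rotated])
qed


section \<open>An explicit stationary solution\<close>

definition similarity_profile :: "(real \<Rightarrow> complex) \<Rightarrow> real \<Rightarrow> complex" where
  "similarity_profile w x = (if x > 0 then of_real (x powr (1/6)) * w (x powr (2/3)) else 0)"

text \<open>
  In \<open>\<phi> = x^(1/6) w(x^(2/3))\<close> the two contributions of \<open>w'\<close> to \<open>\<phi>''\<close> have coefficients \<open>1/9\<close> and \<open>-1/9\<close> and
  cancel, the contribution of \<open>w\<close> is \<open>-5/36 x^(-2)\<phi>\<close> and cancels the potential, and both \<open>w''\<close> and the
  nonlinear term come with \<open>x^(-1/2)\<close>. Hence the equation for \<open>w\<close> is autonomous.
\<close>

lemma similarity_profile_stationary: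
  fixes w w' w'' :: "real \<Rightarrow> complex"
  assumes d1: "\<And>z. z > 0 \<Longrightarrow> (w has_vector_derivative w' z) (at z)"
    and d2: "\<And>z. z > 0 \<Longrightarrow> (w' has_vector_derivative w'' z) (at z)"
    and ode: "\<And>z. z > 0 \<Longrightarrow>
      4 / 9 * w'' z + (of_real \<epsilon> + \<i> * of_real \<gamma>) * of_real ((cmod (w z))\<^sup>2) * w z = 0"
  shows "\<exists>\<phi>' \<phi>''. \<forall>y. y \<noteq> 0 \<longrightarrow>
    (similarity_profile w has_vector_derivative \<phi>' y) (at y) \<and>
    (\<phi>' has_vector_derivative \<phi>'' y) (at y) \<and>
    stationary_solution_at \<epsilon> \<gamma> y (similarity_profile w y) (\<phi>'' y)"
proof -
  define \<phi>' where "\<phi>' = (\<lambda>x. if x > 0 then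
      of_real (1/6 * x powr (-5/6)) * w (x powr (2/3)) + of_real (2/3 * x powr (-1/6)) * w' (x powr (2/3))
    else 0)"
  define \<phi>'' where "\<phi>'' = (\<lambda>x. if x > 0 then
      of_real (4/9 * x powr (-1/2)) * w'' (x powr (2/3)) - of_real (5/36 * x powr (-11/6)) * w (x powr (2/3))
    else 0)"
  have mult_comp: "((\<lambda>x. of_real (a * x powr b) * f (x powr (2/3))) has_vector_derivative
      of_real (2/3 * a * x powr (b - 1/3)) * f' (x powr (2/3)) + of_real (a * b * x powr (b - 1)) * f (x powr (2/3))) (at x)"
    if x: "x > 0" and f: "\<And>z. z > 0 \<Longrightarrow> (f has_vector_derivative f' z) (at z)"
    for x a b :: real and f f' :: "real \<Rightarrow> complex"
  proof -
    have 1: "((\<lambda>x. complex_of_real (a * x powr b)) has_vector_derivative of_real (a * b * x powr (b - 1))) (at x)"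
      by (intro has_vector_derivative_of_real) (use x in \<open>auto intro!: derivative_eq_intros\<close>)
    have 2: "((\<lambda>x. x powr (2/3)) has_vector_derivative 2/3 * x powr (-1/3)) (at x)"
      unfolding has_real_derivative_iff_has_vector_derivative[symmetric]
      using x by (auto intro!: derivative_eq_intros)
    have "x powr (2/3) > 0" using x by simp
    from vector_diff_chain_at[OF 2 f[OF this]]
    have 3: "((\<lambda>x. f (x powr (2/3))) has_vector_derivative of_real (2/3 * x powr (-1/3)) * f' (x powr (2/3))) (at x)"
      by (simp add: o_def scaleR_conv_of_real)
    have 4: "x powr (b - 1/3) = x powr b * x powr (-1/3)"
      by (simp flip: powr_add)
    show ?thesis
      by (rule has_vector_derivative_eq_rhs[OF has_vector_derivative_mult[OF 1 3]]) (simp add: 4)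
  qed
  have "(similarity_profile w has_vector_derivative \<phi>' y) (at y) \<and>
    (\<phi>' has_vector_derivative \<phi>'' y) (at y) \<and>
    stationary_solution_at \<epsilon> \<gamma> y (similarity_profile w y) (\<phi>'' y)" if "y \<noteq> 0" for y
  proof (cases "y > 0")
    case False
    with that have y: "y < 0" by simp
    have "(f has_vector_derivative 0) (at y)" if "\<And>x. x < 0 \<Longrightarrow> f x = 0" for f :: "real \<Rightarrow> complex"
      by (rule has_vector_derivative_transform_within_open[of "\<lambda>_. 0" _ _ "{..<0}"]) (use y that in auto)
    then show ?thesis
      using y by (auto simp: similarity_profile_def \<phi>'_def \<phi>''_def stationary_solution_at_def)
  next
    case y: True
    define z where "z = y powr (2/3)"
    have z: "z > 0" using y by (simp add: z_def)
    have "((\<lambda>x. of_real (1 * x powr (1/6)) * w (x powr (2/3))) has_vector_derivative \<phi>' y) (at y)"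
      by (rule has_vector_derivative_eq_rhs[OF mult_comp[OF y d1]]) (use y in \<open>simp_all add: \<phi>'_def\<close>)
    then have "(similarity_profile w has_vector_derivative \<phi>' y) (at y)"
      by (rule has_vector_derivative_transform_within_open[of _ _ _ "{0<..}"])
        (use y in \<open>auto simp: similarity_profile_def\<close>)
    moreover have "((\<lambda>x. of_real (1/6 * x powr (-5/6)) * w (x powr (2/3)) +
        of_real (2/3 * x powr (-1/6)) * w' (x powr (2/3))) has_vector_derivative \<phi>'' y) (at y)"
      by (rule has_vector_derivative_eq_rhs[OF has_vector_derivative_add[OF mult_comp[OF y d1] mult_comp[OF y d2]]])
        (use y in \<open>simp_all add: \<phi>''_def\<close>)
    then have "(\<phi>' has_vector_derivative \<phi>'' y) (at y)"
      by (rule has_vector_derivative_transform_within_open[of _ _ _ "{0<..}"])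
        (use y in \<open>auto simp: \<phi>'_def\<close>)
    moreover have "stationary_solution_at \<epsilon> \<gamma> y (similarity_profile w y) (\<phi>'' y)"
    proof -
      have inv: "1 / y = y powr (-1)" "1 / y\<^sup>2 = y powr (-2)"
        using y by (simp_all add: powr_minus_divide)
      have p1: "1 / y * ((y powr (1/6))\<^sup>2 * y powr (1/6)) = y powr (-1/2)"
        by (simp only: inv power2_eq_square powr_add[symmetric]) simp
      have p2: "1 / y\<^sup>2 * y powr (1/6) = y powr (-11/6)"
        by (simp only: inv powr_add[symmetric]) simp
      have prof: "similarity_profile w y = of_real (y powr (1/6)) * w z"
        using y by (simp add: similarity_profile_def z_def)
      have n: "(cmod (similarity_profile w y))\<^sup>2 = (y powr (1/6))\<^sup>2 * (cmod (w z))\<^sup>2"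
        by (simp add: prof norm_mult power_mult_distrib)
      have "(of_real \<epsilon> + \<i> * of_real \<gamma>) * of_real (1 / y) * of_real ((cmod (similarity_profile w y))\<^sup>2) * similarity_profile w y
        = of_real (1 / y * ((y powr (1/6))\<^sup>2 * y powr (1/6))) * ((of_real \<epsilon> + \<i> * of_real \<gamma>) * of_real ((cmod (w z))\<^sup>2) * w z)"
        unfolding n by (simp add: prof mult_ac)
      moreover have "of_real (5 / 36) * of_real (1 / y\<^sup>2) * similarity_profile w y
        = of_real (5/36 * (1 / y\<^sup>2 * y powr (1/6))) * w z"
        by (simp add: prof)
      moreover have "\<phi>'' y = of_real (y powr (-1/2)) * (4/9 * w'' z) - of_real (5/36 * y powr (-11/6)) * w z"
        using y by (simp add: \<phi>''_def z_def)
      ultimately have "\<phi>'' y + (of_real \<epsilon> + \<i> * of_real \<gamma>) * of_real (1 / y) * of_real ((cmod (similarity_profile w y))\<^sup>2) * similarity_profile w y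
          + of_real (5 / 36) * of_real (1 / y\<^sup>2) * similarity_profile w y
        = of_real (y powr (-1/2)) * (4/9 * w'' z + (of_real \<epsilon> + \<i> * of_real \<gamma>) * of_real ((cmod (w z))\<^sup>2) * w z)"
        unfolding p1 p2 by (simp only: ring_distribs) simp
      then show ?thesis
        unfolding stationary_solution_at_def ode[OF z] by simp
    qed
    ultimately show ?thesis by blast
  qed
  then show ?thesis by blast
qed

text \<open>
  With \<open>c = -1 + i\<theta>\<close>, the imaginary part of the condition gives \<open>\<theta> = 3\<gamma>A^2/4\<close>, and the real part
  becomes the quadratic equation \<open>\<gamma>^2a^2 - 4\<epsilon>a - 32/9 = 0\<close> for \<open>a = A^2\<close>. For \<open>\<gamma> \<noteq> 0\<close> the product of its
  roots is negative, so there is a positive one whatever the sign of \<open>\<epsilon>\<close>.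
\<close>

lemma exists_power_parameters:
  fixes \<epsilon> \<gamma> :: real
  assumes "\<epsilon> \<in> {1, -1}" "\<gamma> \<noteq> 0"
  shows "\<exists>A c. A > 0 \<and> Re c = -1 \<and>
    4 / 9 * c * (c - 1) + (of_real \<epsilon> + \<i> * of_real \<gamma>) * of_real (A\<^sup>2) = 0"
proof -
  define s where "s = sqrt (1 + 8 * \<gamma>\<^sup>2 / 9)"
  define a where "a = 2 * (\<epsilon> + s) / \<gamma>\<^sup>2"
  define \<theta> where "\<theta> = 3 * \<gamma> * a / 4"
  have s2: "s\<^sup>2 = 1 + 8 * \<gamma>\<^sup>2 / 9" unfolding s_def by simp
  have "s > 1" unfolding s_def using assms by simp
  then have a: "a > 0" unfolding a_def using assms by auto
  have e2: "\<epsilon>\<^sup>2 = 1" using assms by auto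
  have "a * \<gamma>\<^sup>2 = 2 * (\<epsilon> + s)" using assms by (simp add: a_def)
  then have "(a * \<gamma>\<^sup>2)\<^sup>2 - 4 * \<epsilon> * (a * \<gamma>\<^sup>2) = 4 * (s\<^sup>2 - \<epsilon>\<^sup>2)"
    by (simp add: power2_eq_square algebra_simps)
  also have "\<dots> = \<gamma>\<^sup>2 * (32 / 9)" by (simp add: s2 e2)
  finally have "\<gamma>\<^sup>2 * (a\<^sup>2 * \<gamma>\<^sup>2 - 4 * \<epsilon> * a) = \<gamma>\<^sup>2 * (32 / 9)"
    by (simp add: power2_eq_square algebra_simps)
  then have quad: "a\<^sup>2 * \<gamma>\<^sup>2 - 4 * \<epsilon> * a = 32 / 9"
    using assms by (simp only: mult_cancel_left) simp
  have "4 / 9 * Complex (-1) \<theta> * (Complex (-1) \<theta> - 1) + (of_real \<epsilon> + \<i> * of_real \<gamma>) * of_real ((sqrt a)\<^sup>2) = 0"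
    using a quad by (simp add: complex_eq_iff \<theta>_def field_simps power2_eq_square)
  then show ?thesis
    using a by (intro exI[of _ "sqrt a"] exI[of _ "Complex (-1) \<theta>"]) auto
qed

lemma has_vector_derivative_shifted_powr:
  assumes "(z::real) > 0"
  shows "((\<lambda>z. complex_of_real (1 + z) powr c) has_vector_derivative c * of_real (1 + z) powr (c - 1)) (at z)"
proof -
  have 1: "((\<lambda>z. complex_of_real (1 + z)) has_vector_derivative of_real 1) (at z)"
    by (intro has_vector_derivative_of_real) (auto intro!: derivative_eq_intros)
  have 2: "((\<lambda>u. u powr c) has_field_derivative c * of_real (1 + z) powr (c - 1)) (at (complex_of_real (1 + z)))"
    using assms by (intro has_field_derivative_powr) (simp add: complex_nonpos_Reals_iff)
  from field_vector_diff_chain_at[OF 1 2] show ?thesis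
    by (simp add: o_def)
qed

text \<open>
  Because \<open>Re c = -1\<close>, the cubic term \<open>|w|^2w\<close> of \<open>w = A(1 + z)^c\<close> is a multiple of \<open>(1 + z)^(c-2)\<close>, the same
  power as \<open>w''\<close>; the equation is then a relation between the coefficients. The second derivative
  appears here in the form in which differentiating twice produces it.
\<close>

lemma power_solves_emden_equation:
  assumes z: "(z::real) > 0" and c: "Re c = -1"
    and rel: "4 / 9 * c * (c - 1) + \<kappa> * of_real (A\<^sup>2) = 0"
  defines "w \<equiv> of_real A * of_real (1 + z) powr c"
  shows "4 / 9 * (of_real A * (c * ((c - 1) * of_real (1 + z) powr (c - 2))))
    + \<kappa> * of_real ((cmod w)\<^sup>2) * w = 0"
proof -
  have "cmod w = \<bar>A\<bar> / (1 + z)"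
    using z c by (simp add: w_def norm_mult norm_powr_real_powr powr_minus divide_inverse)
  then have n: "(cmod w)\<^sup>2 = A\<^sup>2 / (1 + z)\<^sup>2" by (simp add: power_divide)
  have ne: "complex_of_real (1 + z) \<noteq> 0" using z by (simp only: of_real_eq_0_iff)
  define P where "P = complex_of_real (1 + z) powr c"
  define Q where "Q = complex_of_real ((1 + z)\<^sup>2)"
  have "complex_of_real (1 + z) powr (c - 2) = P / Q"
    using ne powr_nat'[of "complex_of_real (1 + z)" 2] by (simp add: powr_diff P_def Q_def)
  moreover have "of_real ((cmod w)\<^sup>2) = of_real (A\<^sup>2) / Q"
    unfolding n Q_def by (rule of_real_divide)
  moreover have "w = of_real A * P" by (simp add: w_def P_def)
  moreover have "4 / 9 * (of_real A * (c * ((c - 1) * (P / Q)))) + \<kappa> * (of_real (A\<^sup>2) / Q) * (of_real A * P)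
    = of_real A * P / Q * (4 / 9 * c * (c - 1) + \<kappa> * of_real (A\<^sup>2))"
    by (simp only: divide_inverse distrib_left mult_ac)
  ultimately show ?thesis by (simp only: rel mult_zero_right)
qed

text \<open>
  The modulus is at most \<open>A\<close> for \<open>x \<le> 1\<close> and at most \<open>A x^(-1/2)\<close> everywhere on the half-line, and
  \<open>x^(-p/2)\<close> is integrable at infinity for \<open>p > 2\<close>. For positivity of the norm, the modulus is bounded
  below by \<open>A/3\<close> on \<open>[1, 2]\<close>.
\<close>

lemma profile_Lp:
  fixes \<phi> :: "real \<Rightarrow> complex"
  assumes p: "p > 2" and A: "A > 0"
    and nrm: "\<And>x. cmod (\<phi> x) = (if x > 0 then A * (x powr (1/6) / (1 + x powr (2/3))) else 0)"
  shows "integrable lborel (\<lambda>x. cmod (\<phi> x) powr p)" and "lp_norm p \<phi> > 0"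
proof -
  define g where "g = (\<lambda>x::real. if x > 0 then (x powr (1/6) / (1 + x powr (2/3))) powr p else 0)"
  have eq: "(\<lambda>x. cmod (\<phi> x) powr p) = (\<lambda>x. A powr p * g x)"
  proof
    fix x show "cmod (\<phi> x) powr p = A powr p * g x"
      using A p by (cases "x > 0") (simp_all only: nrm g_def if_True if_False powr_mult powr_0 mult_zero_right)
  qed
  have meas: "g \<in> borel_measurable lborel"
    unfolding g_def by measurable
  define h where "h = (\<lambda>x. indicator {0..1} x + indicator {1..} x * x powr (-p/2) :: real)"
  have "set_integrable lborel {1..} (\<lambda>x. x powr (-p/2))"
  proof -
    have "(\<lambda>x. x powr (-p/2)) integrable_on {1..}"
      using has_integral_powr_to_inf[of "-p/2" 1] p by (auto simp: integrable_on_def)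
    then have "set_integrable lebesgue {1..} (\<lambda>x. x powr (-p/2))"
      by (subst absolutely_integrable_on_iff_nonneg) auto
    then show ?thesis
      by (simp add: set_integrable_def integrable_completion)
  qed
  then have h: "integrable lborel h"
    unfolding h_def set_integrable_def by (intro Bochner_Integration.integrable_add) auto
  have le: "g x \<le> h x" for x
  proof (cases "x > 0")
    case True
    have "g x \<le> 1" if "x \<le> 1"
    proof -
      have "x powr (1/6) \<le> 1" using True that by (simp add: powr_le1)
      moreover have pos: "x powr (2/3) > 0" using True by simp
      ultimately have "x powr (1/6) \<le> 1 + x powr (2/3)" by linarith
      moreover have "1 + x powr (2/3) > 0" using pos by linarith
      ultimately have "x powr (1/6) / (1 + x powr (2/3)) \<le> 1"
        by (simp only: divide_le_eq_1_pos)
      then have "(x powr (1/6) / (1 + x powr (2/3))) powr p \<le> 1"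
        using p by (intro powr_le1) auto
      then show ?thesis by (simp add: g_def)
    qed
    moreover have "g x \<le> x powr (-p/2)" 
    proof -
      have "x powr (1/6) / (1 + x powr (2/3)) \<le> x powr (1/6) / x powr (2/3)"
        using True by (intro divide_left_mono) (auto intro!: mult_pos_pos add_pos_pos)
      also have "\<dots> = x powr (-1/2)" by (simp flip: powr_diff)
      finally have "(x powr (1/6) / (1 + x powr (2/3))) powr p \<le> (x powr (-1/2)) powr p"
        using p by (intro powr_mono2) auto
      then show ?thesis using True by (simp add: g_def powr_powr)
    qed
    ultimately show ?thesis using True by (auto simp: h_def indicator_def)
  qed (simp add: g_def h_def)
  have g: "integrable lborel g"
  proof (rule Bochner_Integration.integrable_bound[OF h meas], rule AE_I2)
    fix x
    have "0 \<le> g x" by (simp add: g_def)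
    then show "norm (g x) \<le> norm (h x)" using le[of x] by simp
  qed
  then show "integrable lborel (\<lambda>x. cmod (\<phi> x) powr p)"
    unfolding eq by simp
  have low: "(1/3) powr p * indicator {1..2} x \<le> g x" for x :: real
  proof (cases "x \<in> {1..2}")
    case True
    have "x powr (2/3) \<le> x powr 1" using True by (intro powr_mono) auto
    moreover have "x powr (1/6) \<ge> 1" using True by (intro ge_one_powr_ge_zero) auto
    ultimately have "1/3 \<le> x powr (1/6) / (1 + x powr (2/3))"
      using True by (intro frac_le add_pos_pos) auto
    then show ?thesis using True p by (auto simp: g_def intro!: powr_mono2)
  qed (auto simp: g_def)
  have "0 < (1/3) powr p * measure lborel {1..2::real}" by simp
  also have "\<dots> = (LINT x|lborel. (1/3) powr p * indicator {1..2::real} x)" by simp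
  also have "\<dots> \<le> (LINT x|lborel. g x)"
    by (rule integral_mono[OF _ g low]) auto
  finally have "0 < (LINT x|lborel. g x)" .
  then show "lp_norm p \<phi> > 0"
    using A unfolding lp_norm_def eq by simp
qed

section \<open>Existence of blow-up solutions\<close>

theorem theorem1:
  fixes \<epsilon> \<gamma> T :: real
  assumes "\<epsilon> \<in> {1, -1}" and "\<gamma> \<noteq> 0" and "T > 0"
  shows "\<exists>\<psi> :: real \<Rightarrow> real \<Rightarrow> complex.
    classical_solution \<epsilon> \<gamma> T \<psi> \<and>
    (\<forall>p>2.
      (\<forall>t\<in>{0..<T}. integrable lborel (\<lambda>x. cmod (\<psi> x t) powr p)) \<and>
      filterlim (\<lambda>t. lp_norm p (\<lambda>x. \<psi> x t)) at_top (at_left T))"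
proof -
  obtain A c where A: "A > 0" and c: "Re c = -1"
    and rel: "4 / 9 * c * (c - 1) + (of_real \<epsilon> + \<i> * of_real \<gamma>) * of_real (A\<^sup>2) = 0"
    using exists_power_parameters[OF assms(1,2)] by blast
  define w where "w = (\<lambda>z::real. of_real A * of_real (1 + z) powr c)"
  define \<phi> where "\<phi> = similarity_profile w"
  have d1: "(w has_vector_derivative of_real A * (c * of_real (1 + z) powr (c - 1))) (at z)" if "z > 0" for z
    unfolding w_def using that
    by (intro has_vector_derivative_mult_right has_vector_derivative_shifted_powr)
  have d2: "((\<lambda>z::real. of_real A * (c * of_real (1 + z) powr (c - 1))) has_vector_derivative
      of_real A * (c * ((c - 1) * of_real (1 + z) powr (c - 2)))) (at z)" if "z > 0" for z
    using that has_vector_derivative_shifted_powr[of z "c - 1"]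
    by (intro has_vector_derivative_mult_right) simp
  have ode: "4 / 9 * (of_real A * (c * ((c - 1) * of_real (1 + z) powr (c - 2))))
      + (of_real \<epsilon> + \<i> * of_real \<gamma>) * of_real ((cmod (w z))\<^sup>2) * w z = 0" if "z > 0" for z :: real
    unfolding w_def by (rule power_solves_emden_equation[OF that c rel])
  have "\<exists>\<phi>' \<phi>''. \<forall>y. y \<noteq> 0 \<longrightarrow> (\<phi> has_vector_derivative \<phi>' y) (at y) \<and>
      (\<phi>' has_vector_derivative \<phi>'' y) (at y) \<and> stationary_solution_at \<epsilon> \<gamma> y (\<phi> y) (\<phi>'' y)"
    unfolding \<phi>_def by (rule similarity_profile_stationary[OF d1 d2 ode])
  then obtain \<phi>' \<phi>'' where "\<forall>y. y \<noteq> 0 \<longrightarrow> (\<phi> has_vector_derivative \<phi>' y) (at y) \<and>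
      (\<phi>' has_vector_derivative \<phi>'' y) (at y) \<and> stationary_solution_at \<epsilon> \<gamma> y (\<phi> y) (\<phi>'' y)"
    by (elim exE)
  then have sol: "classical_solution \<epsilon> \<gamma> T (pseudoconformal T \<phi>)"
    by (intro pseudoconformal_classical_solution[of \<phi> \<phi>' \<phi>'']) simp_all
  have modulus: "cmod (\<phi> x) = (if x > 0 then A * (x powr (1/6) / (1 + x powr (2/3))) else 0)" for x
  proof (cases "x > 0")
    case True
    have "cmod (w z) = A / (1 + z)" if "z > 0" for z
      using that A c by (simp add: w_def norm_mult norm_powr_real_powr powr_minus divide_inverse)
    then show ?thesis
      using True by (simp add: \<phi>_def similarity_profile_def norm_mult)
  qed (simp add: \<phi>_def similarity_profile_def)
  have Lp: "integrable lborel (\<lambda>x. cmod (\<phi> x) powr p)" "lp_norm p \<phi> > 0" if "p > 2" for p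
    using profile_Lp[OF that A modulus] by this
  show ?thesis
  proof (intro exI[of _ "pseudoconformal T \<phi>"] conjI allI impI ballI)
    fix p t :: real
    assume "p > 2" and "t \<in> {0..<T}"
    then show "integrable lborel (\<lambda>x. cmod (pseudoconformal T \<phi> x t) powr p)"
      by (intro integrable_pseudoconformal Lp) simp_all
  next
    fix p :: real
    assume "p > 2"
    then show "filterlim (\<lambda>t. lp_norm p (\<lambda>x. pseudoconformal T \<phi> x t)) at_top (at_left T)"
      by (intro pseudoconformal_blowup Lp)
  qed (rule sol)
qed

end
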